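(* Let $\Pi(n)$ be the probability (under $P_p$) that the origin of $\mathbb{Z}^2$ changes state after time $n$, i.e. that $\omega_m(o)\neq\omega_n(o)$ for some $m>n$, where $o$ denotes the origin. Then, for each $p\in[0,1]$ there exists $c_0>0$ such that $\Pi(n)\leq \exp(-c_0\, n)$ for all $n$.
   Context: Two sites of $\mathbb{Z}^2$ are neighbors if they are at Euclidean distance $1$ (each site has four neighbors). The initial configuration $\omega=\omega_0\in\{0,1\}^{\mathbb{Z}^2}$ is chosen according to $P_p$, the product of Bernoulli measures with parameter $p$ (each site is independently $1$ with probability $p$ and $0$ with probability $1-p$). The (bootstrap) dynamics is deterministic, in discrete time $n=1,2,\ldots$, with all sites updated simultaneously: $1$'s remain $1$ forever, and a $0$ becomes $1$ at the next update if and only if it has at least three neighbors (out of four) that are $1$. $\omega_n$ denotes the configuration after $n$ updates. *)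

theory Defs
  imports "HOL-Probability.Probability"
begin

type_synonym site = "int \<times> int"

text \<open>\<^const>\<open>True\<close> is the state 1, \<^const>\<open>False\<close> the state 0.\<close>

type_synonym config = "site \<Rightarrow> bool"

definition neighbor :: "site \<Rightarrow> site \<Rightarrow> bool" where
  "neighbor x y \<longleftrightarrow>
     dist (real_of_int (fst x), real_of_int (snd x)) (real_of_int (fst y), real_of_int (snd y)) = 1"

definition bootstrap_step :: "config \<Rightarrow> config" where
  "bootstrap_step \<omega> = (\<lambda>x. \<omega> x \<or> card {y. neighbor x y \<and> \<omega> y} \<ge> 3)"

definition config_at :: "nat \<Rightarrow> config \<Rightarrow> config" where
  "config_at n \<omega> = (bootstrap_step ^^ n) \<omega>"

definition initial_measure :: "real \<Rightarrow> config measure" where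
  "initial_measure p = (\<Pi>\<^sub>M x\<in>UNIV. measure_pmf (bernoulli_pmf p))"

definition origin :: site where
  "origin = (0, 0)"

definition change_prob :: "real \<Rightarrow> nat \<Rightarrow> real" where
  "change_prob p n =
     measure (initial_measure p)
       {\<omega> \<in> space (initial_measure p). \<exists>m>n. config_at m \<omega> origin \<noteq> config_at n \<omega> origin}"

lemma neighbor_iff:
  "neighbor x y \<longleftrightarrow>
     y \<in> {(fst x + 1, snd x), (fst x - 1, snd x), (fst x, snd x + 1), (fst x, snd x - 1)}"
proof -
  obtain a b where x: "x = (a, b)" by (cases x)
  obtain c d where y: "y = (c, d)" by (cases y)
  have "neighbor x y \<longleftrightarrow> (real_of_int a - real_of_int c)\<^sup>2 + (real_of_int b - real_of_int d)\<^sup>2 = 1"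
    by (simp add: x y neighbor_def dist_Pair_Pair dist_real_def)
  also have "\<dots> \<longleftrightarrow> real_of_int ((a - c)\<^sup>2 + (b - d)\<^sup>2) = real_of_int 1"
    by simp
  also have "\<dots> \<longleftrightarrow> (a - c)\<^sup>2 + (b - d)\<^sup>2 = 1"
    by (rule of_int_eq_iff)
  also have "\<dots> \<longleftrightarrow> (a - c = 0 \<and> \<bar>b - d\<bar> = 1) \<or> (\<bar>a - c\<bar> = 1 \<and> b - d = 0)"
  proof
    assume h: "(a - c)\<^sup>2 + (b - d)\<^sup>2 = 1"
    have "(a - c)\<^sup>2 \<ge> 0" "(b - d)\<^sup>2 \<ge> 0" by simp_all
    with h consider "(a - c)\<^sup>2 = 0" "(b - d)\<^sup>2 = 1" | "(a - c)\<^sup>2 = 1" "(b - d)\<^sup>2 = 0"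
      by linarith
    then show "(a - c = 0 \<and> \<bar>b - d\<bar> = 1) \<or> (\<bar>a - c\<bar> = 1 \<and> b - d = 0)"
      by cases (auto simp: power2_eq_1_iff)
  next
    assume "(a - c = 0 \<and> \<bar>b - d\<bar> = 1) \<or> (\<bar>a - c\<bar> = 1 \<and> b - d = 0)"
    then show "(a - c)\<^sup>2 + (b - d)\<^sup>2 = 1"
      by (elim disjE conjE) (simp_all add: abs_square_eq_1)
  qed
  also have "\<dots> \<longleftrightarrow> y \<in> {(a + 1, b), (a - 1, b), (a, b + 1), (a, b - 1)}"
    unfolding y by auto
  finally show ?thesis by (simp add: x)
qed

lemma finite_neighbors: "finite {y. neighbor x y}"
  by (simp add: neighbor_iff)

lemma card_neighbors: "card {y. neighbor x y} = 4"
  unfolding neighbor_iff Collect_mem_eq by simp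

lemma prob_space_initial_measure: "prob_space (initial_measure p)"
  unfolding initial_measure_def by (intro prob_space_PiM prob_space_measure_pmf)

lemma measurable_config_at:
  "(\<lambda>\<omega>. config_at n \<omega> x) \<in> measurable (initial_measure p) (count_space UNIV)"
proof (induction n arbitrary: x)
  case 0
  have "(\<lambda>\<omega>. \<omega> x) \<in> measurable (initial_measure p) (measure_pmf (bernoulli_pmf p))"
    unfolding initial_measure_def by (rule measurable_component_singleton) simp
  then show ?case by (simp add: config_at_def cong: measurable_cong_sets)
next
  case (Suc n)
  note [measurable] = Suc.IH
  have "card {y. neighbor x y \<and> P y} = (\<Sum>y | neighbor x y. if P y then 1 else 0)" for P
    using finite_neighbors[of x] by (simp add: sum.If_cases Collect_conj_eq)
  then have "config_at (Suc n) \<omega> x \<longleftrightarrow>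
      config_at n \<omega> x \<or> (\<Sum>y | neighbor x y. if config_at n \<omega> y then 1 else (0::nat)) \<ge> 3" for \<omega>
    by (simp add: config_at_def bootstrap_step_def)
  then show ?case by simp
qed

lemma change_event_sets:
  "{\<omega> \<in> space (initial_measure p). \<exists>m>n. config_at m \<omega> x \<noteq> config_at n \<omega> x}
     \<in> sets (initial_measure p)"
proof -
  note [measurable] = measurable_config_at
  show ?thesis by measurable
qed

end

theory Submission
  imports Defs
begin

text \<open>
  A site flips exactly when at most one of its neighbors is still 0, so the dynamics peels leaves
  off the graph of zeros. Suppose that the origin flips between times \<open>M\<close> and \<open>M + 1\<close>. At time
  \<open>M\<close> it has at most one neighbor \<open>y\<close> that is 0. Everything that is joined to the origin by
  initial zeros without using \<open>y\<close> was peeled off before, from the outside towards the origin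
  (\<open>cluster_peeled\<close>). This cluster has two properties that rarely occur together.

  First, it is large: a flip at a time that is not the first one is caused by the flip of a neighbor
  one step earlier, so the cluster contains a site for each of the flip times \<open>0, ..., M\<close>
  (\<open>cluster_flip_times\<close>). Second, it meets no \<open>2 \<times> 2\<close> block of zeros, because such a block is a
  cycle and is never peeled off (\<open>zero_block_stable\<close>).

  A large cluster that avoids zero blocks is exponentially unlikely for every \<open>p < 1\<close>, even when
  zeros percolate. Explore the cluster block by block: as long as it leaves the explored region, it
  is adjacent to a site of a fresh block, and with conditional probability at least
  \<open>(1 - p)^4\<close> that block consists of zeros, hence belongs to the cluster and ruins the event.
  So every new block costs a factor \<open>1 - (1 - p)^4\<close> (\<open>adaptive_exploration\<close>,
  \<open>large_cluster_no_zero_block_prob\<close>). A union over the five choices of \<open>y\<close>, where \<open>y\<close> equal to the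
  origin stands for no surviving neighbor, gives \<open>change_prob_le_power\<close>.

  The bound with constant 1 in front needs in addition that the probability is bounded away from 1
  (\<open>change_prob_le_one_block\<close>). For \<open>p = 1\<close> nothing changes almost surely.
\<close>

section \<open>Blocks, cylinders and adaptive exploration\<close>

definition block_of :: "site \<Rightarrow> site" where
  "block_of x = (fst x div 2, snd x div 2)"

definition zero_block :: "config \<Rightarrow> site \<Rightarrow> bool" where
  "zero_block \<omega> b \<longleftrightarrow> (\<forall>x. block_of x = b \<longrightarrow> \<not> \<omega> x)"

definition cylinder :: "site set \<Rightarrow> config \<Rightarrow> config set" where
  "cylinder U \<eta> = {\<omega>. \<forall>x\<in>U. \<omega> x = \<eta> x}"

lemma block_of_vimage_singleton:
  "block_of -` {(i, j)} = {(2 * i, 2 * j), (2 * i + 1, 2 * j), (2 * i, 2 * j + 1), (2 * i + 1, 2 * j + 1)}"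
proof -
  have "a div 2 = k \<longleftrightarrow> a = 2 * k \<or> a = 2 * k + 1" for a k :: int
    by presburger
  then have "(a, b) \<in> block_of -` {(i, j)} \<longleftrightarrow>
      (a = 2 * i \<or> a = 2 * i + 1) \<and> (b = 2 * j \<or> b = 2 * j + 1)" for a b
    by (simp add: block_of_def)
  then show ?thesis
    by (intro set_eqI) (simp add: split_paired_all, blast)
qed

lemma card_block: "card (block_of -` {b}) = 4"
  by (cases b) (simp add: block_of_vimage_singleton)

lemma finite_block: "finite (block_of -` {b})"
  by (cases b) (simp add: block_of_vimage_singleton)

lemma finite_block_vimage: "finite R \<Longrightarrow> finite (block_of -` R)"
  by (subst vimage_eq_UN) (use finite_block in auto)

lemma card_le_4_card_blocks:
  assumes "finite H"
  shows "card H \<le> 4 * card (block_of ` H)"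
proof -
  have "card H \<le> card (\<Union>b\<in>block_of ` H. block_of -` {b})"
    using assms finite_block by (intro card_mono) auto
  also have "\<dots> \<le> (\<Sum>b\<in>block_of ` H. card (block_of -` {b}))"
    using assms by (intro card_UN_le) auto
  finally show ?thesis
    by (simp add: card_block)
qed

lemma space_initial_measure: "space (initial_measure p) = UNIV"
  by (simp add: initial_measure_def space_PiM)

lemma cylinder_eq_emb:
  "cylinder U \<eta> = prod_emb UNIV (\<lambda>_. measure_pmf (bernoulli_pmf p)) U (Pi\<^sub>E U (\<lambda>x. {\<eta> x}))"
  by (intro set_eqI) (simp add: cylinder_def prod_emb_def space_PiM PiE_iff restrict_apply)

lemma cylinder_sets:
  assumes "finite U"
  shows "cylinder U \<eta> \<in> sets (initial_measure p)"
  unfolding initial_measure_def cylinder_eq_emb[of U \<eta> p]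
  using assms by (intro sets_PiM_I) auto

lemma measure_cylinder:
  assumes "finite U"
  shows "measure (initial_measure p) (cylinder U \<eta>) = (\<Prod>x\<in>U. pmf (bernoulli_pmf p) (\<eta> x))"
proof -
  have "emeasure (initial_measure p) (cylinder U \<eta>)
      = (\<Prod>x\<in>U. emeasure (measure_pmf (bernoulli_pmf p)) {\<eta> x})"
    unfolding initial_measure_def cylinder_eq_emb[of U \<eta> p]
    using assms by (intro emeasure_PiM_emb) (auto simp: prob_space_measure_pmf)
  also have "\<dots> = ennreal (\<Prod>x\<in>U. pmf (bernoulli_pmf p) (\<eta> x))"
    by (simp add: emeasure_pmf_single prod_ennreal)
  finally show ?thesis
    by (simp add: measure_def prod_nonneg)
qed

text \<open>
  This is the abstract form of an exploration in which every newly revealed block may end the event.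
  The hypothesis says that what has been seen on the blocks \<open>R\<close> determines a fresh block \<open>b\<close> that
  may not be entirely 0 if \<open>A\<close> is to occur. Revealing \<open>b\<close> then costs a factor
  \<open>1 - (1 - p)^4\<close>, and this can be repeated \<open>N\<close> times. The conclusion is about a measurable
  superset of \<open>A\<close>, because \<open>A\<close> is an arbitrary set of configurations.
\<close>

lemma adaptive_exploration:
  fixes p :: real and A :: "config set"
  assumes p: "0 \<le> p" "p \<le> 1"
    and step: "\<And>R \<eta>. finite R \<Longrightarrow> card R < N \<Longrightarrow>
      \<exists>b. b \<notin> R \<and> (\<forall>\<omega>\<in>A \<inter> cylinder (block_of -` R) \<eta>. \<not> zero_block \<omega> b)"
  shows "\<exists>B\<in>sets (initial_measure p). A \<subseteq> B \<and> measure (initial_measure p) B \<le> (1 - (1 - p) ^ 4) ^ N"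
proof -
  interpret prob_space "initial_measure p"
    by (rule prob_space_initial_measure)
  define q where "q = (1 - p) ^ 4"
  have q: "0 \<le> q" "q \<le> 1"
    unfolding q_def using p by (auto intro: power_le_one)
  \<comment> \<open>Conditionally on the states \<open>\<eta>\<close> seen on \<open>R\<close>, each of the \<open>k\<close> steps that remain costs a factor.\<close>
  have main: "\<exists>B\<in>events. A \<inter> cylinder (block_of -` R) \<eta> \<subseteq> B
        \<and> prob B \<le> (1 - q) ^ k * prob (cylinder (block_of -` R) \<eta>)"
    if "finite R" "card R + k = N" for R \<eta> k
    using that
  proof (induction k arbitrary: R \<eta>)
    case 0
    then show ?case
      by (intro bexI[of _ "cylinder (block_of -` R) \<eta>"])
        (auto intro!: cylinder_sets finite_block_vimage)
  next
    case (Suc k)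
    have "card R < N"
      using Suc.prems(2) by simp
    from step[OF Suc.prems(1) this, of \<eta>] obtain b where
      b: "b \<notin> R" and nonzero: "\<And>\<omega>. \<omega> \<in> A \<Longrightarrow> \<omega> \<in> cylinder (block_of -` R) \<eta> \<Longrightarrow> \<not> zero_block \<omega> b"
      by blast
    define U where "U = block_of -` R"
    define C where "C = block_of -` {b}"
    define V where "V = block_of -` insert b R"
    have fin: "finite U" "finite C" "finite V"
      unfolding U_def C_def V_def using Suc.prems(1) by (simp_all add: finite_block_vimage del: vimage_insert)
    have UCV: "V = U \<union> C" and disj: "U \<inter> C = {}"
      unfolding U_def C_def V_def using b by blast+
    \<comment> \<open>The cylinder over \<open>U\<close> is split according to the states \<open>\<xi>\<close> of the new block. The all-zero
      state \<open>zeta\<close> cannot occur on \<open>A\<close>, and \<open>E\<close> collects the others.\<close>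
    define upd where "upd \<xi> = (\<lambda>x. if x \<in> C then \<xi> x else \<eta> x)" for \<xi>
    define zeta where "zeta = (\<lambda>x\<in>C. False)"
    define E where "E = (C \<rightarrow>\<^sub>E (UNIV :: bool set)) - {zeta}"
    have finE: "finite E"
      unfolding E_def using fin by (intro finite_Diff finite_PiE) auto
    have inV: "\<omega> \<in> cylinder V (upd \<xi>) \<longleftrightarrow> \<omega> \<in> cylinder U \<eta> \<and> (\<forall>x\<in>C. \<omega> x = \<xi> x)" for \<omega> \<xi>
      using disj by (auto simp: cylinder_def UCV upd_def)
    have evV: "cylinder V \<xi> \<in> events" for \<xi>
      using fin by (intro cylinder_sets)
    have "\<exists>B. B \<in> events \<and> A \<inter> cylinder V (upd \<xi>) \<subseteq> B
        \<and> prob B \<le> (1 - q) ^ k * prob (cylinder V (upd \<xi>))" for \<xi>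
      using Suc.IH[of "insert b R" "upd \<xi>"] Suc.prems b unfolding V_def by auto
    then have "\<exists>B. \<forall>\<xi>. B \<xi> \<in> events \<and> A \<inter> cylinder V (upd \<xi>) \<subseteq> B \<xi>
        \<and> prob (B \<xi>) \<le> (1 - q) ^ k * prob (cylinder V (upd \<xi>))"
      by (intro choice allI)
    then obtain B where B: "\<And>\<xi>. B \<xi> \<in> events" "\<And>\<xi>. A \<inter> cylinder V (upd \<xi>) \<subseteq> B \<xi>"
        "\<And>\<xi>. prob (B \<xi>) \<le> (1 - q) ^ k * prob (cylinder V (upd \<xi>))"
      by blast
    have probzero: "prob (cylinder V (upd zeta)) = q * prob (cylinder U \<eta>)"
    proof -
      have "prob (cylinder V (upd zeta))
          = (\<Prod>x\<in>U. pmf (bernoulli_pmf p) (upd zeta x)) * (\<Prod>x\<in>C. pmf (bernoulli_pmf p) (upd zeta x))"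
        unfolding measure_cylinder[OF fin(3)] unfolding UCV using fin disj by (simp add: prod.union_disjoint)
      also have "(\<Prod>x\<in>U. pmf (bernoulli_pmf p) (upd zeta x)) = prob (cylinder U \<eta>)"
        unfolding measure_cylinder[OF fin(1)] using disj by (intro prod.cong) (auto simp: upd_def)
      also have "(\<Prod>x\<in>C. pmf (bernoulli_pmf p) (upd zeta x)) = (\<Prod>x\<in>C. 1 - p)"
        using p by (intro prod.cong) (auto simp: upd_def zeta_def)
      also have "\<dots> = q"
        by (simp add: q_def C_def card_block)
      finally show ?thesis
        by simp
    qed
    have "disjoint_family_on (\<lambda>\<xi>. cylinder V (upd \<xi>)) E"
    proof (unfold disjoint_family_on_def, intro ballI impI)
      fix \<xi> \<xi>' assume "\<xi> \<in> E" "\<xi>' \<in> E" "\<xi> \<noteq> \<xi>'"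
      then have "\<not> (\<forall>x\<in>C. \<xi> x = \<xi>' x)"
        using PiE_ext[of \<xi> C "\<lambda>_. UNIV" \<xi>'] unfolding E_def by blast
      then obtain x where "x \<in> C" "\<xi> x \<noteq> \<xi>' x"
        by blast
      then show "cylinder V (upd \<xi>) \<inter> cylinder V (upd \<xi>') = {}"
        by (auto simp: inV)
    qed
    then have "(\<Sum>\<xi>\<in>E. prob (cylinder V (upd \<xi>))) = prob (\<Union>\<xi>\<in>E. cylinder V (upd \<xi>))"
      using finE evV by (intro finite_measure_finite_Union[symmetric]) auto
    also have "\<dots> \<le> prob (cylinder U \<eta> - cylinder V (upd zeta))"
    proof (intro finite_measure_mono sets.Diff evV cylinder_sets fin)
      have "\<xi> = zeta" if "\<xi> \<in> C \<rightarrow>\<^sub>E UNIV" "\<forall>x\<in>C. \<omega> x = \<xi> x" "\<forall>x\<in>C. \<omega> x = zeta x" for \<omega> \<xi>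
        using that by (intro PiE_ext[of _ C "\<lambda>_. UNIV"]) (auto simp: zeta_def)
      then show "(\<Union>\<xi>\<in>E. cylinder V (upd \<xi>)) \<subseteq> cylinder U \<eta> - cylinder V (upd zeta)"
        unfolding E_def by (auto simp: inV)
    qed
    also have "\<dots> = (1 - q) * prob (cylinder U \<eta>)"
      using probzero evV cylinder_sets[OF fin(1)]
      by (subst finite_measure_Diff) (auto simp: inV algebra_simps)
    finally have sum_le: "(\<Sum>\<xi>\<in>E. prob (cylinder V (upd \<xi>))) \<le> (1 - q) * prob (cylinder U \<eta>)" .
    have "prob (\<Union>\<xi>\<in>E. B \<xi>) \<le> (\<Sum>\<xi>\<in>E. prob (B \<xi>))"
      using finE B(1) by (intro finite_measure_subadditive_finite) auto
    also have "\<dots> \<le> (1 - q) ^ k * (\<Sum>\<xi>\<in>E. prob (cylinder V (upd \<xi>)))"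
      unfolding sum_distrib_left by (intro sum_mono B)
    also have "\<dots> \<le> (1 - q) ^ k * ((1 - q) * prob (cylinder U \<eta>))"
      using q sum_le by (intro mult_left_mono) auto
    finally have "prob (\<Union>\<xi>\<in>E. B \<xi>) \<le> (1 - q) ^ Suc k * prob (cylinder U \<eta>)"
      by (simp add: algebra_simps)
    moreover have "A \<inter> cylinder U \<eta> \<subseteq> (\<Union>\<xi>\<in>E. B \<xi>)"
    proof
      fix \<omega> assume \<omega>: "\<omega> \<in> A \<inter> cylinder U \<eta>"
      then have "\<not> zero_block \<omega> b"
        using nonzero by (auto simp: U_def)
      then obtain x where x: "x \<in> C" "\<omega> x"
        by (auto simp: zero_block_def C_def)
      have "restrict \<omega> C x \<noteq> zeta x"
        using x by (simp add: zeta_def)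
      then have "restrict \<omega> C \<in> E"
        unfolding E_def by auto
      moreover have "\<omega> \<in> cylinder V (upd (restrict \<omega> C))"
        using \<omega> by (simp add: inV)
      ultimately show "\<omega> \<in> (\<Union>\<xi>\<in>E. B \<xi>)"
        using B(2) \<omega> by blast
    qed
    moreover have "(\<Union>\<xi>\<in>E. B \<xi>) \<in> events"
      using finE B(1) by auto
    ultimately show ?case
      unfolding U_def by blast
  qed
  have "cylinder (block_of -` {}) undefined = (UNIV :: config set)" "prob UNIV = 1"
    using prob_space by (simp_all add: cylinder_def space_initial_measure)
  with main[of "{}" N undefined] show ?thesis
    by (simp add: q_def)
qed

section \<open>Zero clusters\<close>

text \<open>
  The start \<open>a\<close> belongs to the cluster whatever its state, and \<open>y\<close> may only occur in it as the
  start. Restricting the cluster to a region \<open>U\<close> makes it depend on the states in \<open>U\<close> alone, as an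
  exploration requires.
\<close>

inductive cluster :: "site set \<Rightarrow> site \<Rightarrow> config \<Rightarrow> site \<Rightarrow> site \<Rightarrow> bool"
  for U y \<omega> a where
  base: "cluster U y \<omega> a a"
| step: "cluster U y \<omega> a x \<Longrightarrow> neighbor x z \<Longrightarrow> z \<in> U \<Longrightarrow> z \<noteq> y \<Longrightarrow> \<not> \<omega> z \<Longrightarrow> cluster U y \<omega> a z"

lemma cluster_local:
  assumes "cluster U y \<omega> a x" and "\<And>z. z \<in> U \<Longrightarrow> \<omega>' z = \<omega> z"
  shows "cluster UNIV y \<omega>' a x"
  using assms
proof induction
  case base
  then show ?case
    by (simp add: cluster.base)
next
  case (step x z)
  then show ?case
    using cluster.step[of UNIV y \<omega>' a x z] by simp
qed

lemma cluster_exit: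
  assumes "cluster UNIV y \<omega> a x" "x \<notin> U" "a \<in> U"
  shows "\<exists>x' z. cluster U y \<omega> a x' \<and> neighbor x' z \<and> z \<notin> U \<and> z \<noteq> y"
proof (rule ccontr)
  assume "\<not> ?thesis"
  then have *: "cluster U y \<omega> a x' \<Longrightarrow> neighbor x' z \<Longrightarrow> z \<noteq> y \<Longrightarrow> z \<in> U" for x' z
    by blast
  from assms(1) have "cluster U y \<omega> a x \<and> x \<in> U"
  proof induction
    case base
    then show ?case
      using assms(3) by (simp add: cluster.base)
  next
    case (step x z)
    then show ?case
      using *[of x z] cluster.step[of U y \<omega> a x z] by simp
  qed
  with assms(2) show False
    by blast
qed

text \<open>
  The size is measured by a finite set \<open>H\<close> of witnesses, since the cluster may be infinite and
  \<open>card\<close> would then be 0.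
\<close>

definition large_cluster_no_zero_block :: "site \<Rightarrow> site \<Rightarrow> nat \<Rightarrow> config set" where
  "large_cluster_no_zero_block a y N = {\<omega>.
     (\<exists>H. finite H \<and> H \<subseteq> {x. cluster UNIV y \<omega> a x} \<and> N \<le> card (block_of ` H)) \<and>
     (\<forall>x. cluster UNIV y \<omega> a x \<longrightarrow> \<not> zero_block \<omega> (block_of x))}"

text \<open>
  The next block to be revealed is the one of \<open>a\<close> at the start, and later the one of a site \<open>z\<close>
  adjacent to the cluster inside the explored region. There is such a \<open>z\<close> as long as fewer than
  \<open>N\<close> blocks are explored, because the cluster meets at least \<open>N\<close> of them. If the block of \<open>z\<close>
  were entirely 0, then \<open>z\<close> would join the cluster, which avoids zero blocks.
\<close>

lemma large_cluster_no_zero_block_prob: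
  assumes "0 \<le> p" "p \<le> 1"
  shows "\<exists>B\<in>sets (initial_measure p). large_cluster_no_zero_block a y N \<subseteq> B
    \<and> measure (initial_measure p) B \<le> (1 - (1 - p) ^ 4) ^ N"
proof (rule adaptive_exploration[OF assms])
  fix R :: "site set" and \<eta> :: config
  assume R: "finite R" "card R < N"
  let ?A = "large_cluster_no_zero_block a y N" and ?U = "block_of -` R"
  have "infinite (UNIV :: site set)"
    by (simp add: finite_prod)
  then obtain b0 :: site where b0: "b0 \<notin> R"
    using R(1) ex_new_if_finite by blast
  \<comment> \<open>In the last case, one sample \<open>\<omega>1\<close> from the event serves to find \<open>z\<close>. By locality the same
    \<open>z\<close> works for every configuration that agrees with it on the explored region.\<close>
  consider "?A \<inter> cylinder ?U \<eta> = {}" | "block_of a \<notin> R"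
    | \<omega>1 where "\<omega>1 \<in> ?A" "\<omega>1 \<in> cylinder ?U \<eta>" "block_of a \<in> R"
    by blast
  then show "\<exists>b. b \<notin> R \<and> (\<forall>\<omega>\<in>?A \<inter> cylinder ?U \<eta>. \<not> zero_block \<omega> b)"
  proof cases
    case 1
    with b0 show ?thesis
      by (intro exI[of _ b0]) simp
  next
    case 2
    moreover have "\<not> zero_block \<omega> (block_of a)" if "\<omega> \<in> ?A" for \<omega>
      using that cluster.base[of UNIV y \<omega> a] unfolding large_cluster_no_zero_block_def by blast
    ultimately show ?thesis
      by blast
  next
    case 3
    then obtain H where H: "finite H" "H \<subseteq> {x. cluster UNIV y \<omega>1 a x}" "N \<le> card (block_of ` H)"
      by (auto simp: large_cluster_no_zero_block_def)
    have "\<not> block_of ` H \<subseteq> R"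
      using card_mono[OF R(1), of "block_of ` H"] H(3) R(2) by linarith
    then obtain x where "cluster UNIV y \<omega>1 a x" "x \<notin> ?U"
      using H(2) by blast
    then obtain x' z where z: "cluster ?U y \<omega>1 a x'" "neighbor x' z" "z \<notin> ?U" "z \<noteq> y"
      using cluster_exit[of y \<omega>1 a x ?U] 3(3) by auto
    have "\<not> zero_block \<omega> (block_of z)" if \<omega>: "\<omega> \<in> ?A" "\<omega> \<in> cylinder ?U \<eta>" for \<omega>
    proof
      assume zb: "zero_block \<omega> (block_of z)"
      have "cluster UNIV y \<omega> a x'"
        using cluster_local[OF z(1), of \<omega>] \<omega>(2) 3(2) by (auto simp: cylinder_def)
      moreover have "\<not> \<omega> z"
        using zb unfolding zero_block_def by blast
      ultimately have "cluster UNIV y \<omega> a z"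
        using cluster.step[of UNIV y \<omega> a x' z] z(2,4) by simp
      with zb \<omega>(1) show False
        unfolding large_cluster_no_zero_block_def by blast
    qed
    with z(3) show ?thesis
      by (intro exI[of _ "block_of z"]) auto
  qed
qed

section \<open>The dynamics\<close>

definition flips_after :: "nat \<Rightarrow> config \<Rightarrow> site \<Rightarrow> bool" where
  "flips_after t \<omega> x \<longleftrightarrow> \<not> config_at t \<omega> x \<and> config_at (Suc t) \<omega> x"

lemma config_at_0: "config_at 0 \<omega> = \<omega>"
  by (simp add: config_at_def)

lemma config_at_Suc:
  "config_at (Suc t) \<omega> x \<longleftrightarrow> config_at t \<omega> x \<or> 3 \<le> card {y. neighbor x y \<and> config_at t \<omega> y}"
  by (simp add: config_at_def bootstrap_step_def)

lemma neighbor_sym: "neighbor x y \<Longrightarrow> neighbor y x"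
  by (simp add: neighbor_def dist_commute)

lemma config_at_mono: "config_at s \<omega> x \<Longrightarrow> s \<le> t \<Longrightarrow> config_at t \<omega> x"
  by (induction t) (auto simp: config_at_Suc le_Suc_eq)

lemma flip_time_unique: "flips_after s \<omega> x \<Longrightarrow> flips_after t \<omega> x \<Longrightarrow> s = t"
  by (metis flips_after_def config_at_mono Suc_leI linorder_neqE_nat)

lemma config_at_flips:
  assumes "config_at t \<omega> x" "\<not> config_at s \<omega> x"
  shows "\<exists>u\<ge>s. u < t \<and> flips_after u \<omega> x"
  using assms
proof (induction t)
  case 0
  then show ?case
    using config_at_mono[of 0] by blast
next
  case (Suc t)
  show ?case
  proof (cases "config_at t \<omega> x")
    case True
    with Suc show ?thesis
      using less_Suc_eq by blast
  next
    case False
    moreover have "s \<le> t"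
      using Suc.prems config_at_mono[of "Suc t" \<omega> x s] by force
    ultimately show ?thesis
      using Suc.prems by (intro exI[of _ t]) (auto simp: flips_after_def)
  qed
qed

text \<open>
  Three of four neighbors are 1: a site that flips is a leaf or an isolated point of the current
  graph of zeros.
\<close>

lemma flip_zero_neighbor_unique:
  assumes "flips_after t \<omega> x" "neighbor x u" "neighbor x v"
    and "\<not> config_at t \<omega> u" "\<not> config_at t \<omega> v"
  shows "u = v"
proof (rule ccontr)
  assume "u \<noteq> v"
  have "card {y. neighbor x y \<and> config_at t \<omega> y} \<le> card ({y. neighbor x y} - {u, v})"
    using assms(4,5) finite_neighbors by (intro card_mono) auto
  also have "\<dots> = 4 - 2"
    using \<open>u \<noteq> v\<close> assms(2,3) by (subst card_Diff_subset) (auto simp: card_neighbors)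
  finally show False
    using assms(1) by (simp add: flips_after_def config_at_Suc)
qed

lemma flip_caused_by_neighbor:
  assumes "flips_after (Suc t) \<omega> x"
  shows "\<exists>z. neighbor x z \<and> flips_after t \<omega> z"
proof (rule ccontr)
  assume "\<not> ?thesis"
  then have "{y. neighbor x y \<and> config_at (Suc t) \<omega> y} \<subseteq> {y. neighbor x y \<and> config_at t \<omega> y}"
    by (auto simp: flips_after_def)
  then have "card {y. neighbor x y \<and> config_at (Suc t) \<omega> y} \<le> card {y. neighbor x y \<and> config_at t \<omega> y}"
    using finite_neighbors by (intro card_mono) auto
  with assms show False
    by (auto simp: flips_after_def config_at_Suc[of "Suc t"] config_at_Suc[of t \<omega> x])
qed

lemma two_neighbors_in_block:
  "\<exists>u v. u \<noteq> v \<and> neighbor x u \<and> neighbor x v \<and> block_of u = block_of x \<and> block_of v = block_of x"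
proof -
  have *: "\<exists>k'. (k' = k + 1 \<or> k' = k - 1) \<and> k' div 2 = k div 2" for k :: int
    by presburger
  obtain i j where x: "x = (i, j)"
    by (cases x)
  obtain i' j' where "i' = i + 1 \<or> i' = i - 1" "i' div 2 = i div 2"
      "j' = j + 1 \<or> j' = j - 1" "j' div 2 = j div 2"
    using * by meson
  then show ?thesis
    by (intro exI[of _ "(i', j)"] exI[of _ "(i, j')"]) (auto simp: x neighbor_iff block_of_def)
qed

text \<open>
  Each site of a \<open>2 \<times> 2\<close> block has two neighbors in the block, so none can be the first to flip.
\<close>

lemma zero_block_stable:
  assumes "zero_block \<omega> (block_of x)"
  shows "\<not> config_at t \<omega> x"
  using assms
proof (induction t arbitrary: x)
  case 0
  then show ?case
    unfolding config_at_0 zero_block_def by blast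
next
  case (Suc t)
  obtain u v where "u \<noteq> v" "neighbor x u" "neighbor x v" "block_of u = block_of x" "block_of v = block_of x"
    using two_neighbors_in_block by blast
  then show ?case
    using flip_zero_neighbor_unique[of t \<omega> x u v] Suc.IH[of x] Suc.IH[of u] Suc.IH[of v] Suc.prems
    by (auto simp: flips_after_def)
qed

text \<open>
  The derivation remembers from which neighbor a site was reached and that this neighbor flips
  later. This is what the proof of \<open>cluster_peeled\<close> has to look back at.
\<close>

inductive peeled :: "config \<Rightarrow> site \<Rightarrow> nat \<Rightarrow> site \<Rightarrow> nat \<Rightarrow> bool" for \<omega> a M where
  root: "peeled \<omega> a M a M"
| child: "peeled \<omega> a M x s \<Longrightarrow> neighbor x z \<Longrightarrow> flips_after t \<omega> z \<Longrightarrow> t < s \<Longrightarrow> peeled \<omega> a M z t"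

lemma peeled_flips: "peeled \<omega> a M x s \<Longrightarrow> flips_after M \<omega> a \<Longrightarrow> flips_after s \<omega> x"
  by (induction rule: peeled.induct) auto

text \<open>
  Going outwards from \<open>a\<close>, flip times decrease. When \<open>x\<close> flips, the site \<open>w\<close> from which it was
  reached is still 0 and takes the only place for a zero neighbor, so every other neighbor \<open>z\<close> of
  \<open>x\<close> has flipped before. At the root \<open>a\<close> that place is taken by \<open>y\<close>, which the cluster avoids.
  A step back to \<open>w\<close> is harmless, as \<open>w\<close> is peeled already.
\<close>

lemma cluster_peeled:
  assumes a: "flips_after M \<omega> a"
    and y: "\<And>z. neighbor a z \<Longrightarrow> \<not> config_at M \<omega> z \<Longrightarrow> z = y"
    and x: "cluster UNIV y \<omega> a x"
  shows "\<exists>t. peeled \<omega> a M x t"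
  using x
proof induction
  case base
  then show ?case
    by (blast intro: peeled.root)
next
  case (step x z)
  then obtain s where s: "peeled \<omega> a M x s"
    by blast
  have early: "\<exists>t. peeled \<omega> a M z t" if z: "config_at s \<omega> z"
  proof -
    obtain t where "t < s" "flips_after t \<omega> z"
      using config_at_flips[OF z, of 0] \<open>\<not> \<omega> z\<close> unfolding config_at_0 by blast
    then show ?thesis
      using peeled.child[OF s step(2)] by blast
  qed
  from s show ?case
  proof cases
    case root
    with y step early show ?thesis
      by blast
  next
    case (child w r)
    show ?thesis
    proof (cases "z = w")
      case True
      with child show ?thesis
        by blast
    next
      case False
      have "\<not> config_at s \<omega> w"
        using peeled_flips[OF child(1) a] child(4) config_at_mono[of s \<omega> w r]
        by (auto simp: flips_after_def)
      then have "config_at s \<omega> z"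
        using flip_zero_neighbor_unique[OF child(3) neighbor_sym[OF child(2)] step(2)] False by blast
      then show ?thesis
        by (rule early)
    qed
  qed
qed

text \<open>
  Chains of causes run backwards in time from the flip of \<open>a\<close>. They stay in the cluster because
  \<open>y\<close> is still 0 at time \<open>M\<close> and so causes none of these flips.
\<close>

lemma cluster_flip_times:
  assumes "flips_after M \<omega> a" "\<not> config_at M \<omega> y" "k \<le> M"
  shows "\<exists>x. cluster UNIV y \<omega> a x \<and> flips_after k \<omega> x"
  using assms(3)
proof (induction rule: inc_induct)
  case base
  then show ?case
    using assms(1) by (blast intro: cluster.base)
next
  case (step k)
  then obtain x where x: "cluster UNIV y \<omega> a x" "flips_after (Suc k) \<omega> x"
    by blast
  then obtain z where z: "neighbor x z" "flips_after k \<omega> z"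
    using flip_caused_by_neighbor by blast
  have "z \<noteq> y"
    using z(2) assms(2) step.hyps config_at_mono[of "Suc k" \<omega> y M] by (auto simp: flips_after_def)
  moreover have "\<not> \<omega> z"
    using z(2) config_at_mono[of 0 \<omega> z k] by (auto simp: flips_after_def config_at_0)
  ultimately show ?case
    using cluster.step[OF x(1) z(1)] z(2) by blast
qed

text \<open>
  The \<open>M + 1\<close> sites with flip times \<open>0, ..., M\<close> are distinct and each block holds at most four of
  them, so at least \<open>(M + 1) / 4\<close> blocks are met. Rounding up turns this into the hypothesis
  \<open>4 * N \<le> M + 4\<close>.
\<close>

lemma late_flip_large_cluster_no_zero_block:
  assumes a: "flips_after M \<omega> a" and N: "4 * N \<le> M + 4"
  shows "\<exists>y\<in>insert a {z. neighbor a z}. \<omega> \<in> large_cluster_no_zero_block a y N"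
proof -
  \<comment> \<open>If no neighbor is 0 at time \<open>M\<close>, then \<open>y = a\<close> excludes nothing but a return to \<open>a\<close>.\<close>
  obtain y where y: "y \<in> insert a {z. neighbor a z}" "\<not> config_at M \<omega> y"
      "\<And>z. neighbor a z \<Longrightarrow> \<not> config_at M \<omega> z \<Longrightarrow> z = y"
  proof (cases "\<exists>z. neighbor a z \<and> \<not> config_at M \<omega> z")
    case True
    then show ?thesis
      using that flip_zero_neighbor_unique[OF a] by blast
  next
    case False
    then show ?thesis
      using that[of a] a by (auto simp: flips_after_def)
  qed
  have "\<forall>k. \<exists>x. k \<le> M \<longrightarrow> cluster UNIV y \<omega> a x \<and> flips_after k \<omega> x"
    using cluster_flip_times[OF a y(2)] by blast
  then obtain f where f: "\<And>k. k \<le> M \<Longrightarrow> cluster UNIV y \<omega> a (f k)" "\<And>k. k \<le> M \<Longrightarrow> flips_after k \<omega> (f k)"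
    by metis
  have "inj_on f {..M}"
    by (rule inj_onI) (metis f(2) flip_time_unique atMost_iff)
  then have "Suc M = card (f ` {..M})"
    by (simp add: card_image)
  also have "\<dots> \<le> 4 * card (block_of ` f ` {..M})"
    by (intro card_le_4_card_blocks) auto
  finally have "N \<le> card (block_of ` f ` {..M})"
    using N by linarith
  then have "\<exists>H. finite H \<and> H \<subseteq> {x. cluster UNIV y \<omega> a x} \<and> N \<le> card (block_of ` H)"
    using f(1) by (intro exI[of _ "f ` {..M}"]) auto
  moreover have "\<not> zero_block \<omega> (block_of x)" if x: "cluster UNIV y \<omega> a x" for x
  proof -
    obtain t where "peeled \<omega> a M x t"
      using cluster_peeled[OF a y(3) x] by blast
    then have "config_at (Suc t) \<omega> x"
      using peeled_flips[OF _ a] by (simp add: flips_after_def)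
    then show ?thesis
      using zero_block_stable by blast
  qed
  ultimately have "\<omega> \<in> large_cluster_no_zero_block a y N"
    unfolding large_cluster_no_zero_block_def by blast
  with y(1) show ?thesis
    by blast
qed

section \<open>The estimate\<close>

lemma change_flips:
  assumes "\<exists>m>n. config_at m \<omega> x \<noteq> config_at n \<omega> x"
  shows "\<exists>M\<ge>n. flips_after M \<omega> x"
proof -
  from assms obtain m where "m > n" "config_at m \<omega> x \<noteq> config_at n \<omega> x"
    by blast
  then have "config_at m \<omega> x" "\<not> config_at n \<omega> x"
    using config_at_mono[of n \<omega> x m] by auto
  then show ?thesis
    using config_at_flips by blast
qed

lemma change_prob_le:
  assumes "B \<in> sets (initial_measure p)"
    and "\<And>\<omega> M. n \<le> M \<Longrightarrow> flips_after M \<omega> origin \<Longrightarrow> \<omega> \<in> B"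
  shows "change_prob p n \<le> measure (initial_measure p) B"
proof -
  interpret prob_space "initial_measure p"
    by (rule prob_space_initial_measure)
  have "{\<omega> \<in> space (initial_measure p). \<exists>m>n. config_at m \<omega> origin \<noteq> config_at n \<omega> origin} \<subseteq> B"
    using change_flips[of n _ origin] assms(2) by (intro subsetI) (elim CollectE conjE, metis)
  with assms(1) show ?thesis
    unfolding change_prob_def by (intro finite_measure_mono)
qed

lemma change_prob_le_one_site:
  assumes "0 \<le> p" "p \<le> 1"
  shows "change_prob p n \<le> 1 - p"
proof -
  have "change_prob p n \<le> measure (initial_measure p) (cylinder {origin} (\<lambda>_. False))"
    using config_at_mono[of 0 _ origin]
    by (intro change_prob_le cylinder_sets) (auto simp: cylinder_def flips_after_def config_at_0)
  with assms show ?thesis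
    by (simp add: measure_cylinder)
qed

text \<open>
  If the block of the origin is entirely 0, then the origin never changes. This bound is below 1 for
  every \<open>p < 1\<close>, uniformly in \<open>n\<close>.
\<close>

lemma change_prob_le_one_block:
  assumes "0 \<le> p" "p \<le> 1"
  shows "change_prob p n \<le> 1 - (1 - p) ^ 4"
proof -
  let ?A = "{\<omega>. \<not> zero_block \<omega> (block_of origin)}"
  have "\<exists>B\<in>sets (initial_measure p). ?A \<subseteq> B \<and> measure (initial_measure p) B \<le> (1 - (1 - p) ^ 4) ^ 1"
  proof (rule adaptive_exploration[OF assms])
    fix R :: "site set" and \<eta> :: config
    assume "finite R" "card R < 1"
    then show "\<exists>b. b \<notin> R \<and> (\<forall>\<omega>\<in>?A \<inter> cylinder (block_of -` R) \<eta>. \<not> zero_block \<omega> b)"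
      by (intro exI[of _ "block_of origin"]) auto
  qed
  then obtain B where B: "B \<in> sets (initial_measure p)" "?A \<subseteq> B"
      "measure (initial_measure p) B \<le> 1 - (1 - p) ^ 4"
    by auto
  have "change_prob p n \<le> measure (initial_measure p) B"
  proof (rule change_prob_le[OF B(1)])
    fix \<omega> M assume "flips_after M \<omega> origin"
    then show "\<omega> \<in> B"
      using B(2) zero_block_stable[of \<omega> origin "Suc M"] by (auto simp: flips_after_def)
  qed
  with B(3) show ?thesis
    by linarith
qed

lemma change_prob_le_power:
  assumes "0 \<le> p" "p \<le> 1" and N: "4 * N \<le> n + 4"
  shows "change_prob p n \<le> 5 * (1 - (1 - p) ^ 4) ^ N"
proof -
  interpret prob_space "initial_measure p"
    by (rule prob_space_initial_measure)
  let ?Y = "insert origin {z. neighbor origin z}"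
  have "\<exists>B. \<forall>y. B y \<in> events \<and> large_cluster_no_zero_block origin y N \<subseteq> B y
      \<and> prob (B y) \<le> (1 - (1 - p) ^ 4) ^ N"
    using large_cluster_no_zero_block_prob[OF assms(1,2), of origin _ N] by (intro choice allI) blast
  then obtain B where B: "\<And>y. B y \<in> events" "\<And>y. large_cluster_no_zero_block origin y N \<subseteq> B y"
      "\<And>y. prob (B y) \<le> (1 - (1 - p) ^ 4) ^ N"
    by blast
  have Y: "finite ?Y" "card ?Y = 5"
    using finite_neighbors[of origin] card_neighbors[of origin]
    by (simp_all add: card_insert_if neighbor_def)
  have "change_prob p n \<le> prob (\<Union>y\<in>?Y. B y)"
  proof (rule change_prob_le)
    show "(\<Union>y\<in>?Y. B y) \<in> events"
      using Y B(1) by blast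
    fix \<omega> M assume "n \<le> M" "flips_after M \<omega> origin"
    then have "\<exists>y\<in>?Y. \<omega> \<in> large_cluster_no_zero_block origin y N"
      using late_flip_large_cluster_no_zero_block[of M \<omega> origin N] N by linarith
    with B(2) show "\<omega> \<in> (\<Union>y\<in>?Y. B y)"
      by blast
  qed
  also have "\<dots> \<le> (\<Sum>y\<in>?Y. prob (B y))"
    using Y B(1) by (intro finite_measure_subadditive_finite) blast+
  also have "\<dots> \<le> (\<Sum>y\<in>?Y. (1 - (1 - p) ^ 4) ^ N)"
    by (intro sum_mono B)
  finally show ?thesis
    using Y by simp
qed

text \<open>
  The bound \<open>r < 1\<close> absorbs the constant 5: it yields the exponential estimate up to a time
  \<open>n0\<close> for any rate at most \<open>- ln r / n0\<close>, and \<open>n0\<close> is chosen so that afterwards the geometric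
  estimate gives this rate as well.
\<close>

lemma exponential_of_geometric:
  fixes a :: "nat \<Rightarrow> real"
  assumes r: "0 \<le> r" "r < 1"
    and small: "\<And>n. a n \<le> r" and geo: "\<And>n N. 4 * N \<le> n + 4 \<Longrightarrow> a n \<le> 5 * r ^ N"
  shows "\<exists>c>0. \<forall>n. a n \<le> exp (- c * real n)"
proof (cases "r = 0")
  case True
  have "a n \<le> exp (- 1 * real n)" for n
    using small[of n] True by (meson exp_ge_zero order_trans)
  then show ?thesis
    by (intro exI[of _ 1]) auto
next
  case False
  define L where "L = - ln r"
  have L: "L > 0" "r = exp (- L)"
    using r False by (auto simp: L_def)
  \<comment> \<open>Beyond \<open>n0\<close> the factor 5 uses up at most half of the exponent \<open>L * n / 4\<close>.\<close>
  define n0 where "n0 = 8 * ln 5 / L + 8"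
  have n0: "n0 \<ge> 8"
    using L by (simp add: n0_def)
  have "a n \<le> exp (- (L / n0) * real n)" for n
  proof (cases "real n \<le> n0")
    case True
    have "L / n0 * real n \<le> L / n0 * n0"
      using True L n0 by (intro mult_left_mono) auto
    then have "r \<le> exp (- (L / n0) * real n)"
      using n0 L by simp
    with small[of n] show ?thesis
      by linarith
  next
    case big: False
    define N where "N = (n + 4) div 4"
    have N: "4 * N \<le> n + 4" "real n \<le> 4 * real N"
      unfolding N_def by linarith+
    have "ln 5 \<le> L * real n / 8"
      using big L by (simp add: n0_def field_simps)
    moreover have "L * real n / 4 \<le> L * real N"
      using N(2) L by (simp add: field_simps)
    moreover have "L * real n / n0 \<le> L * real n / 8"
      using n0 L by (intro divide_left_mono) auto
    ultimately have le: "ln 5 - L * real N \<le> - (L / n0) * real n"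
      by simp
    have "a n \<le> 5 * r ^ N"
      by (rule geo[OF N(1)])
    also have "\<dots> = exp (ln 5 - L * real N)"
      by (simp add: L(2) exp_diff exp_minus divide_inverse power_inverse exp_of_nat2_mult)
    also have "\<dots> \<le> exp (- (L / n0) * real n)"
      using le by simp
    finally show ?thesis .
  qed
  with L n0 show ?thesis
    by (intro exI[of _ "L / n0"]) auto
qed

theorem theorem1:
  fixes p :: real
  assumes "0 \<le> p" and "p \<le> 1"
  shows "\<exists>c0>0. \<forall>n. change_prob p n \<le> exp (- c0 * real n)"
proof (cases "p = 1")
  case True
  have "change_prob p n \<le> exp (- 1 * real n)" for n
    using change_prob_le_one_site[OF assms, of n] True by (simp add: order_trans[OF _ exp_ge_zero])
  then show ?thesis
    by (intro exI[of _ 1]) auto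
next
  case False
  show ?thesis
  proof (rule exponential_of_geometric)
    show "0 \<le> 1 - (1 - p) ^ 4" "1 - (1 - p) ^ 4 < 1"
      using assms False by (auto intro: power_le_one)
  qed (use assms change_prob_le_one_block change_prob_le_power in auto)
qed

end
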